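(* For $n\ge 4$ and $m\ge 2$, $sn(L(n,m))=n+m-3$.
   Context: Graphs are finite, undirected and simple. The lollipop graph $L(n,m)$ is obtained from a complete graph $K_n$ and a path $P_m$ on $m$ vertices by identifying a vertex of $K_n$ with an end vertex of $P_m$ (so it has $n+m-1$ vertices). Let $G=(V,E)$ be a connected graph with chromatic number $\chi(G)=k\ge 2$. For $S\subset V$, a partial coloring on $G[S]$ is a proper coloring $\mathscr C_0$ of the induced subgraph $G[S]$ with colors from $\{1,\dots,k\}$ (not all colors need be used). It is a Sudoku coloring of $G$ if there is exactly one proper $k$-coloring $V\to\{1,\dots,k\}$ of $G$ whose restriction to $S$ is $\mathscr C_0$. The Sudoku number $sn(G)$ is the smallest $|S|$ such that $G[S]$ admits a Sudoku coloring of $G$. *)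

theory Defs
  imports Main "HOL-Library.FuncSet"
begin

record 'a ugraph =
  verts :: "'a set"
  edges :: "'a set set"

definition finite_simple_graph :: "'a ugraph \<Rightarrow> bool" where
  "finite_simple_graph G \<longleftrightarrow>
     finite (verts G) \<and> (\<forall>e \<in> edges G. e \<subseteq> verts G \<and> card e = 2)"

definition connected_graph :: "'a ugraph \<Rightarrow> bool" where
  "connected_graph G \<longleftrightarrow> verts G \<noteq> {} \<and>
     (\<forall>u \<in> verts G. \<forall>v \<in> verts G. (u, v) \<in> {(x, y). {x, y} \<in> edges G}\<^sup>*)"

definition induced_subgraph :: "'a ugraph \<Rightarrow> 'a set \<Rightarrow> 'a ugraph" where
  "induced_subgraph G S = \<lparr>verts = S, edges = {e \<in> edges G. e \<subseteq> S}\<rparr>"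

text \<open>Colorings are extensional functions (equal to \<open>undefined\<close> off the vertex set), so
  that HOL equality of colorings is equality as maps on the vertex set.\<close>

definition proper_coloring :: "'a ugraph \<Rightarrow> nat \<Rightarrow> ('a \<Rightarrow> nat) \<Rightarrow> bool" where
  "proper_coloring G k c \<longleftrightarrow>
     c \<in> verts G \<rightarrow>\<^sub>E {1..k} \<and> (\<forall>u v. {u, v} \<in> edges G \<longrightarrow> c u \<noteq> c v)"

definition chromatic_number :: "'a ugraph \<Rightarrow> nat" where
  "chromatic_number G = (LEAST k. \<exists>c. proper_coloring G k c)"

text \<open>The next two notions are meant for connected finite simple graphs with chromatic number
  at least 2, although the definitions make sense for every finite simple graph.
  The lemmas at the end show that lollipop graphs are of this kind.\<close>

definition sudoku_coloring :: "'a ugraph \<Rightarrow> 'a set \<Rightarrow> ('a \<Rightarrow> nat) \<Rightarrow> bool" where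
  "sudoku_coloring G S c\<^sub>0 \<longleftrightarrow>
     proper_coloring (induced_subgraph G S) (chromatic_number G) c\<^sub>0 \<and>
     (\<exists>!c. proper_coloring G (chromatic_number G) c \<and> restrict c S = c\<^sub>0)"

definition sudoku_number :: "'a ugraph \<Rightarrow> nat" where
  "sudoku_number G =
     (LEAST s. \<exists>S c\<^sub>0. S \<subseteq> verts G \<and> card S = s \<and> sudoku_coloring G S c\<^sub>0)"

definition complete_graph :: "'a set \<Rightarrow> 'a ugraph" where
  "complete_graph A = \<lparr>verts = A, edges = {{u, v} | u v. u \<in> A \<and> v \<in> A \<and> u \<noteq> v}\<rparr>"

text \<open>The path on the \<open>m\<close> vertices \<open>a, a + 1, \<dots>, a + m - 1\<close>, in this order.\<close>

definition path_graph :: "nat \<Rightarrow> nat \<Rightarrow> nat ugraph" where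
  "path_graph a m = \<lparr>verts = {a..<a + m}, edges = {{i, Suc i} | i. a \<le> i \<and> Suc i < a + m}\<rparr>"

definition graph_union :: "'a ugraph \<Rightarrow> 'a ugraph \<Rightarrow> 'a ugraph" where
  "graph_union G H = \<lparr>verts = verts G \<union> verts H, edges = edges G \<union> edges H\<rparr>"

text \<open>For \<open>n, m \<ge> 1\<close> the clique on \<open>{0..<n}\<close> and the path starting at \<open>n - 1\<close> share exactly the
  vertex \<open>n - 1\<close>, so their union is the result of the identification.\<close>

definition lollipop :: "nat \<Rightarrow> nat \<Rightarrow> nat ugraph" where
  "lollipop n m = graph_union (complete_graph {0..<n}) (path_graph (n - 1) m)"

lemma verts_lollipop: "n \<ge> 1 \<Longrightarrow> m \<ge> 1 \<Longrightarrow> verts (lollipop n m) = {0..<n + m - 1}"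
  by (auto simp: lollipop_def graph_union_def complete_graph_def path_graph_def)

lemma lollipop_edge_iff:
  assumes "n \<ge> 1"
  shows "{u, v} \<in> edges (lollipop n m) \<longleftrightarrow>
    (u < n \<and> v < n \<and> u \<noteq> v) \<or>
    (n - 1 \<le> u \<and> v = Suc u \<and> v < n + m - 1) \<or> (n - 1 \<le> v \<and> u = Suc v \<and> u < n + m - 1)"
  using assms
  by (auto simp: lollipop_def graph_union_def complete_graph_def path_graph_def doubleton_eq_iff)

lemma finite_simple_graph_lollipop: "n \<ge> 1 \<Longrightarrow> m \<ge> 1 \<Longrightarrow> finite_simple_graph (lollipop n m)"
  by (auto simp: finite_simple_graph_def lollipop_def graph_union_def complete_graph_def
      path_graph_def)

lemma connected_graph_lollipop:
  assumes "n \<ge> 1" "m \<ge> 1"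
  shows "connected_graph (lollipop n m)"
proof -
  let ?R = "{(x, y). {x, y} \<in> edges (lollipop n m)}"
  have reach: "(0, v) \<in> ?R\<^sup>*" if "v < n + m - 1" for v
    using that
  proof (induction v)
    case (Suc v)
    have "{v, Suc v} \<in> edges (lollipop n m)"
      using Suc.prems assms by (subst lollipop_edge_iff) auto
    then show ?case
      using Suc by (auto intro: rtrancl_into_rtrancl)
  qed simp
  have "sym (?R\<^sup>*)"
    by (intro sym_rtrancl symI) (auto simp: insert_commute)
  then have "(u, v) \<in> ?R\<^sup>*" if "u < n + m - 1" "v < n + m - 1" for u v
    using reach[OF that(1)] reach[OF that(2)] by (meson rtrancl_trans symD)
  then show ?thesis
    using assms by (auto simp: connected_graph_def verts_lollipop)
qed

lemma chromatic_number_lollipop: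
  assumes "n \<ge> 2" "m \<ge> 1"
  shows "chromatic_number (lollipop n m) = n"
  unfolding chromatic_number_def
proof (rule Least_equality)
  let ?c = "restrict (\<lambda>v. v mod n + 1) (verts (lollipop n m))"
  have ne: "v mod n \<noteq> Suc v mod n" for v
    using assms by (auto simp: mod_Suc)
  have "?c u \<noteq> ?c v" if "{u, v} \<in> edges (lollipop n m)" for u v
    using that assms ne[of u] ne[of v]
    by (subst (asm) lollipop_edge_iff) (auto simp: verts_lollipop)
  moreover have "?c \<in> verts (lollipop n m) \<rightarrow>\<^sub>E {1..n}"
    using assms by (auto simp: Suc_le_eq)
  ultimately show "\<exists>c. proper_coloring (lollipop n m) n c"
    unfolding proper_coloring_def by blast
next
  fix k assume "\<exists>c. proper_coloring (lollipop n m) k c"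
  then obtain c where c: "proper_coloring (lollipop n m) k c" ..
  have "inj_on c {0..<n}"
  proof (rule inj_onI, rule ccontr)
    fix u v assume "u \<in> {0..<n}" "v \<in> {0..<n}" "c u = c v" "u \<noteq> v"
    moreover from this have "{u, v} \<in> edges (lollipop n m)"
      using assms by (subst lollipop_edge_iff) auto
    ultimately show False
      using c by (auto simp: proper_coloring_def)
  qed
  moreover have "c ` {0..<n} \<subseteq> {1..k}"
    using c assms by (auto simp: proper_coloring_def verts_lollipop PiE_iff simp del: One_nat_def)
  ultimately have "card {0..<n} \<le> card {1..k}"
    by (intro card_inj_on_le) auto
  then show "n \<le> k" by simp
qed

end

theory Submission imports Defs
begin

text \<open>Upper bound: colour everything except the path's end \<open>n - 1\<close> in the clique and one further
  clique vertex; giving the successor of \<open>n - 1\<close> on the path one of the two colours missing from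
  the clique decides both.  Lower bound: a vertex off the clique has at most two neighbours,
  so it can be recoloured with \<open>n \<ge> 4\<close> colours if it is not given; and if three clique
  vertices are not given, two of them differ from \<open>n - 1\<close>, hence are twins, and
  their colours can be swapped.\<close>

lemma proper_coloring_restrict:
  assumes "proper_coloring G k c" "S \<subseteq> verts G"
  shows "proper_coloring (induced_subgraph G S) k (restrict c S)"
  using assms by (auto simp: proper_coloring_def induced_subgraph_def)

text \<open>Properness ranges over pairs \<open>u\<close>, \<open>v\<close> that may coincide, and
  \<open>{v, v}\<close> collapses to \<open>{v}\<close>; the assumption on \<open>{v}\<close>
  therefore says that there is no loop at \<open>v\<close>.\<close>

lemma proper_coloring_fun_upd:
  assumes c: "proper_coloring G k c"
    and "v \<in> verts G" "a \<in> {1..k}" "{v} \<notin> edges G"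
    and "\<And>u. {u, v} \<in> edges G \<Longrightarrow> c u \<noteq> a"
  shows "proper_coloring G k (c(v := a))"
  using assms by (auto simp: proper_coloring_def PiE_iff extensional_def insert_commute)

text \<open>A third vertex adjacent to one twin is adjacent to both, so its colour already differs
  from both swapped colours.\<close>

lemma proper_coloring_swap_twins:
  assumes c: "proper_coloring G k c"
    and uw: "u \<in> verts G" "w \<in> verts G" "{u} \<notin> edges G" "{w} \<notin> edges G"
    and twins: "\<And>x. x \<noteq> u \<Longrightarrow> x \<noteq> w \<Longrightarrow> {x, u} \<in> edges G \<longleftrightarrow> {x, w} \<in> edges G"
  shows "proper_coloring G k (c(u := c w, w := c u))"
proof -
  have ne: "c x \<noteq> c y" if "{x, y} \<in> edges G" for x y
    using c that by (auto simp: proper_coloring_def)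
  have "(c(u := c w, w := c u)) x \<noteq> (c(u := c w, w := c u)) y"
    if e: "{x, y} \<in> edges G" for x y
    using e uw ne[of x y] ne[of u w] twins[of x] twins[of y] ne[of x u] ne[of x w] ne[of y u] ne[of y w]
    by (auto simp: insert_commute)
  then show ?thesis
    using c uw by (auto simp: proper_coloring_def PiE_iff extensional_def)
qed

text \<open>Trades \<open>restrict\<close> for pointwise agreement on \<open>S\<close>, so that a
  colouring modified only off \<open>S\<close> is at once seen to equal \<open>c\<close>.\<close>

lemma sudoku_coloring_unique:
  assumes "sudoku_coloring G S c\<^sub>0"
  obtains c where "proper_coloring G (chromatic_number G) c"
    "\<And>d. proper_coloring G (chromatic_number G) d \<Longrightarrow> (\<And>v. v \<in> S \<Longrightarrow> d v = c v) \<Longrightarrow> d = c"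
proof -
  from assms obtain c where c: "proper_coloring G (chromatic_number G) c" "restrict c S = c\<^sub>0"
    and u: "\<And>d. proper_coloring G (chromatic_number G) d \<Longrightarrow> restrict d S = c\<^sub>0 \<Longrightarrow> d = c"
    unfolding sudoku_coloring_def by blast
  show thesis
  proof (rule that[OF c(1)])
    fix d assume d: "proper_coloring G (chromatic_number G) d" "\<And>v. v \<in> S \<Longrightarrow> d v = c v"
    have "restrict d S = restrict c S"
      using d(2) by (intro restrict_ext)
    then show "d = c"
      using u d(1) c(2) by simp
  qed
qed

text \<open>The clique vertices are their own residues, and consecutive path vertices have different
  residues modulo \<open>n\<close>.\<close>

lemma proper_coloring_lollipop_mod:
  assumes "n \<ge> 2" "m \<ge> 1"
  shows "proper_coloring (lollipop n m) n (\<lambda>v\<in>{0..<n + m - 1}. v mod n + 1)"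
proof -
  have "v mod n \<noteq> Suc v mod n" for v
    using assms by (auto simp: mod_Suc)
  moreover have "u < n + m - 1" if "u < n" for u
    using that assms by simp
  ultimately show ?thesis
    using assms unfolding proper_coloring_def
    by (auto simp: verts_lollipop lollipop_edge_iff Suc_le_eq dest: sym)
qed

lemma sudoku_coloring_lollipop:
  assumes n: "n \<ge> 3" and m: "m \<ge> 2"
  shows "\<exists>c\<^sub>0. sudoku_coloring (lollipop n m) ({0..<n + m - 1} - {0, n - 1}) c\<^sub>0"
proof -
  let ?G = "lollipop n m" and ?V = "{0..<n + m - 1}"
  let ?S = "?V - {0, n - 1}"
  let ?c = "\<lambda>v\<in>?V. v mod n + 1"
  have V: "verts ?G = ?V" and chi: "chromatic_number ?G = n"
    using n m by (auto simp: verts_lollipop chromatic_number_lollipop)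
  have c: "proper_coloring ?G n ?c"
    using n m by (intro proper_coloring_lollipop_mod) auto
  have "d = ?c" if d: "proper_coloring ?G n d" and r: "restrict d ?S = restrict ?c ?S" for d
  proof -
    have dS: "d v = v mod n + 1" if "v \<in> ?S" for v
      using fun_cong[OF r, of v] that by (simp split: if_splits)
    have adj: "d u \<noteq> d v" if "{u, v} \<in> edges ?G" for u v
      using d that by (auto simp: proper_coloring_def)
    have clique: "d u \<noteq> d v" if "u < n" "v < n" "u \<noteq> v" for u v
      using that n by (intro adj) (auto simp: lollipop_edge_iff)
    have rng: "d v \<in> {1..n}" if "v < n" for v
      using d that m by (auto simp: proper_coloring_def V PiE_iff simp del: One_nat_def)
    have inner: "d v = v + 1" if "0 < v" "v < n - 1" for v
      using dS[of v] that m by simp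
    \<comment> \<open>Since \<open>m \<ge> 2\<close>, the path has a vertex \<open>n\<close>; it
      lies in \<open>?S\<close> with colour \<open>n mod n + 1 = 1\<close>.\<close>
    have "d (n - 1) \<noteq> d n"
      using n m by (intro adj) (auto simp: lollipop_edge_iff)
    then have n1: "d (n - 1) \<noteq> 1"
      using dS[of n] n m by (simp add: less_diff_conv)
    \<comment> \<open>Any other colour is already taken in the clique, namely by the vertex
      \<open>d v - 1\<close>.\<close>
    have outer: "d v = 1 \<or> d v = n" if v: "v = 0 \<or> v = n - 1" for v
    proof (rule ccontr)
      assume "\<not> ?thesis"
      moreover have "v < n"
        using v n by auto
      ultimately have w: "0 < d v - 1" "d v - 1 < n - 1"
        using rng[of v] by auto
      then have "d (d v - 1) = d v"
        using inner by simp
      moreover have "d v - 1 \<noteq> v"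
        using w v by linarith
      moreover have "d v - 1 < n"
        using w by linarith
      ultimately show False
        using clique \<open>v < n\<close> by blast
    qed
    have last: "d (n - 1) = n"
      using outer[of "n - 1"] n1 by blast
    then have first: "d 0 = 1"
      using outer[of 0] clique[of 0 "n - 1"] n by auto
    show ?thesis
    proof (rule extensionalityI)
      show "d \<in> extensional ?V"
        using d by (auto simp: proper_coloring_def V PiE_iff)
      show "d v = ?c v" if "v \<in> ?V" for v
        using that dS[of v] last first n by (cases "v \<in> ?S") auto
    qed simp
  qed
  then show ?thesis
    unfolding sudoku_coloring_def chi
    using c proper_coloring_restrict[OF c, of ?S] V by blast
qed

lemma sudoku_coloring_lollipop_card:
  assumes n: "n \<ge> 4" and m: "m \<ge> 1"
    and S: "S \<subseteq> verts (lollipop n m)" and sud: "sudoku_coloring (lollipop n m) S c\<^sub>0"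
  shows "n + m - 3 \<le> card S"
proof -
  let ?G = "lollipop n m" and ?V = "{0..<n + m - 1}"
  have V: "verts ?G = ?V" and chi: "chromatic_number ?G = n"
    using n m by (auto simp: verts_lollipop chromatic_number_lollipop)
  have irrefl: "{v} \<notin> edges ?G" for v
    using n lollipop_edge_iff[of n v v m] by auto
  obtain c where c: "proper_coloring ?G n c"
    and uniq: "\<And>d. proper_coloring ?G n d \<Longrightarrow> (\<And>v. v \<in> S \<Longrightarrow> d v = c v) \<Longrightarrow> d = c"
    using sudoku_coloring_unique[OF sud] unfolding chi by metis
  have path: "v \<in> S" if v: "n \<le> v" "v \<in> ?V" for v
  proof (rule ccontr)
    assume "v \<notin> S"
    \<comment> \<open>The neighbours of \<open>v\<close> are among \<open>v - 1\<close> and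
      \<open>v + 1\<close>; excluding \<open>c v\<close> too makes the recolouring a real change. If
      \<open>v\<close> ends the path, \<open>c (v + 1)\<close> is merely \<open>undefined\<close>,
      one more excluded value.\<close>
    have "card {c (v - 1), c v, c (v + 1)} \<le> 3"
      by (simp add: card_insert_if)
    then have "\<not> {1..n} \<subseteq> {c (v - 1), c v, c (v + 1)}"
      using n card_mono[of "{c (v - 1), c v, c (v + 1)}" "{1..n}"] by auto
    then obtain a where a: "a \<in> {1..n}" "a \<notin> {c (v - 1), c v, c (v + 1)}"
      by blast
    have "proper_coloring ?G n (c(v := a))"
      using c v a n irrefl by (intro proper_coloring_fun_upd) (auto simp: V lollipop_edge_iff)
    then have "c(v := a) = c"
      using \<open>v \<notin> S\<close> by (intro uniq) auto
    then have "c v = a"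
      by (metis fun_upd_same)
    then show False
      using a by simp
  qed
  have clique: "u = w" if uw: "u < n - 1" "w < n - 1" "u \<notin> S" "w \<notin> S" for u w
  proof (rule ccontr)
    assume ne: "u \<noteq> w"
    \<comment> \<open>Both vertices precede \<open>n - 1\<close>, so they have no neighbours off the
      clique and are twins.\<close>
    have "proper_coloring ?G n (c(u := c w, w := c u))"
      using c uw m n irrefl
      by (intro proper_coloring_swap_twins) (auto simp: V lollipop_edge_iff)
    then have "c(u := c w, w := c u) = c"
      using uw by (intro uniq) auto
    then have "c u = c w"
      using ne by (metis fun_upd_apply)
    moreover have "{u, w} \<in> edges ?G"
      using uw ne n by (auto simp: lollipop_edge_iff)
    ultimately show False
      using c by (auto simp: proper_coloring_def)
  qed
  \<comment> \<open>By \<open>path\<close> and \<open>clique\<close>, at most one vertex besides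
    \<open>n - 1\<close> is not given. If there is none, \<open>x\<close> is arbitrary and 0 is
    taken.\<close>
  obtain x where x: "?V - S \<subseteq> {x, n - 1}"
  proof (cases "\<exists>x. x < n - 1 \<and> x \<notin> S")
    case True
    then obtain x where x: "x < n - 1" "x \<notin> S"
      by blast
    have "v = x \<or> v = n - 1" if "v \<in> ?V" "v \<notin> S" for v
      using clique[of v x] path[of v] x that by linarith
    then show ?thesis
      using that[of x] by blast
  next
    case False
    have "v = n - 1" if "v \<in> ?V" "v \<notin> S" for v
    proof -
      have "\<not> v < n - 1" "\<not> n \<le> v"
        using False path[of v] that by blast+
      then show ?thesis
        by linarith
    qed
    then show ?thesis
      using that[of 0] by blast
  qed
  \<comment> \<open>As \<open>?V\<close> has \<open>n + m - 1\<close> elements, at least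
    \<open>n + m - 3\<close> of them are in \<open>S\<close>.\<close>
  have "card (?V - S) \<le> 2"
    using card_mono[OF _ x] by (auto simp: card_insert_if split: if_splits)
  then show ?thesis
    using S V by (simp add: card_Diff_subset finite_subset)
qed

theorem theorem3p9:
  fixes n m :: nat
  assumes "n \<ge> 4" and "m \<ge> 2"
  shows "sudoku_number (lollipop n m) = n + m - 3"
  unfolding sudoku_number_def
proof (rule Least_equality)
  let ?S = "{0..<n + m - 1} - {0, n - 1}"
  have "card ?S = n + m - 3"
    using assms by (subst card_Diff_subset) auto
  moreover have "?S \<subseteq> verts (lollipop n m)"
    using assms by (auto simp: verts_lollipop)
  moreover have "\<exists>c\<^sub>0. sudoku_coloring (lollipop n m) ?S c\<^sub>0"
    using assms by (intro sudoku_coloring_lollipop) auto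
  ultimately show "\<exists>S c\<^sub>0. S \<subseteq> verts (lollipop n m) \<and> card S = n + m - 3 \<and>
      sudoku_coloring (lollipop n m) S c\<^sub>0"
    by blast
next
  fix s assume "\<exists>S c\<^sub>0. S \<subseteq> verts (lollipop n m) \<and> card S = s \<and>
      sudoku_coloring (lollipop n m) S c\<^sub>0"
  then show "n + m - 3 \<le> s"
    using sudoku_coloring_lollipop_card[of n m] assms by auto
qed

end
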